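(* For every integer $n\geq 2$ there exists an uncountable topological space $X$ which is $T_1$, compact, first countable and $(n+1)$-Hausdorff, but is not $n$-Hausdorff (hence $X$ is neither regular nor normal).
   Context: For a topological space $X$, the Hausdorff number $H(X)$ is the least cardinal $\tau$ (finite or infinite) such that for every subset $A\subset X$ with $|A|\geq\tau$ one can choose, for each $a\in A$, an open neighborhood $U_a\ni a$ so that $\bigcap_{a\in A}U_a=\emptyset$. For an integer $k\geq 2$, $X$ is called $k$-Hausdorff if $H(X)\leq k$. "Compact" means that every open cover has a finite subcover; no separation axiom is included in the definition of compactness. "Regular" means that a closed set and a point outside it have disjoint open neighborhoods; "normal" means that any two disjoint closed sets have disjoint open neighborhoods. *)

theory Defs
  imports "HOL-Analysis.Analysis"
begin

unbundle cardinal_syntax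

(* Cardinals, finite or infinite, are represented by cardinal orders (Card_order). The
   intersection is taken inside X, so that for A = {} it is topspace X rather than UNIV. *)
definition separates_subsets_of_card :: "'a topology \<Rightarrow> 'b rel \<Rightarrow> bool" where
  "separates_subsets_of_card X \<tau> \<longleftrightarrow>
     (\<forall>A. A \<subseteq> topspace X \<and> \<tau> \<le>o |A| \<longrightarrow>
        (\<exists>U. (\<forall>a\<in>A. openin X (U a) \<and> a \<in> U a) \<and> topspace X \<inter> (\<Inter>a\<in>A. U a) = {}))"

definition is_Hausdorff_number :: "'a topology \<Rightarrow> 'a set rel \<Rightarrow> bool" where
  "is_Hausdorff_number X \<tau> \<longleftrightarrow>
     Card_order \<tau> \<and> separates_subsets_of_card X \<tau> \<and>
     (\<forall>\<sigma> :: 'a set rel. Card_order \<sigma> \<and> separates_subsets_of_card X \<sigma> \<longrightarrow> \<tau> \<le>o \<sigma>)"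

(* H(X) never exceeds the cardinality of 'a set, since no subset of X is that large, so it is
   enough to look for the least cardinal among those living on that type: the lemmas below show
   that it exists and that it is least among the cardinals on all types. As a cardinal order it
   is determined only up to order isomorphism. *)
definition Hausdorff_number :: "'a topology \<Rightarrow> 'a set rel" where
  "Hausdorff_number X = (SOME \<tau>. is_Hausdorff_number X \<tau>)"

definition k_Hausdorff :: "nat \<Rightarrow> 'a topology \<Rightarrow> bool" where
  "k_Hausdorff k X \<longleftrightarrow> Hausdorff_number X \<le>o |{..<k}|"

lemma separates_subsets_of_card_mono:
  assumes "separates_subsets_of_card X \<sigma>" "\<sigma> \<le>o \<tau>"
  shows "separates_subsets_of_card X \<tau>"
  using assms(1) ordLeq_transitive[OF assms(2)] unfolding separates_subsets_of_card_def by metis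

lemma separates_subsets_of_card_UNIV:
  fixes X :: "'a topology"
  shows "separates_subsets_of_card X |UNIV :: 'a set set|"
proof -
  have "\<not> |UNIV :: 'a set set| \<le>o |A|" for A :: "'a set"
  proof
    assume "|UNIV :: 'a set set| \<le>o |A|"
    then have "|Pow A| \<le>o |A|"
      by (rule ordLeq_transitive[OF card_of_mono1[OF subset_UNIV]])
    then show False
      using not_ordLess_ordLeq[OF card_of_Pow[of A]] by simp
  qed
  then show ?thesis
    unfolding separates_subsets_of_card_def by simp
qed

lemma is_Hausdorff_number_Hausdorff_number: "is_Hausdorff_number X (Hausdorff_number X)"
proof -
  let ?R = "{\<tau> :: 'a set rel. Card_order \<tau> \<and> separates_subsets_of_card X \<tau>}"
  have "|UNIV :: 'a set set| \<in> ?R"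
    using separates_subsets_of_card_UNIV[of X] card_of_Card_order by simp
  then have "\<exists>\<tau>\<in>?R. \<forall>\<sigma>\<in>?R. \<tau> \<le>o \<sigma>"
    by (intro exists_minim_Card_order) auto
  then have "\<exists>\<tau>. is_Hausdorff_number X \<tau>"
    unfolding is_Hausdorff_number_def by blast
  then show ?thesis
    unfolding Hausdorff_number_def by (rule someI_ex)
qed

lemma Hausdorff_number_least:
  fixes X :: "'a topology" and \<sigma> :: "'b rel"
  assumes "Card_order \<sigma>" "separates_subsets_of_card X \<sigma>"
  shows "Hausdorff_number X \<le>o \<sigma>"
proof -
  note H = is_Hausdorff_number_Hausdorff_number[of X, unfolded is_Hausdorff_number_def]
  have "|UNIV :: 'a set set| \<le>o \<sigma> \<or> \<sigma> \<le>o |UNIV :: 'a set set|"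
    using assms(1) card_of_Well_order unfolding card_order_on_def
    by (intro ordLeq_total) auto
  then show ?thesis
  proof
    assume "|UNIV :: 'a set set| \<le>o \<sigma>"
    moreover have "Hausdorff_number X \<le>o |UNIV :: 'a set set|"
      using H separates_subsets_of_card_UNIV[of X] card_of_Card_order by metis
    ultimately show ?thesis
      by (rule ordLeq_transitive[rotated])
  next
    assume "\<sigma> \<le>o |UNIV :: 'a set set|"
    then obtain \<rho> :: "'a set rel" where \<rho>: "\<sigma> =o \<rho>"
      by (auto simp: internalize_ordLeq[of \<sigma>])
    have "Card_order \<rho>" "separates_subsets_of_card X \<rho>"
      using Card_order_ordIso2[OF assms(1) \<rho>]
        separates_subsets_of_card_mono[OF assms(2) ordIso_imp_ordLeq[OF \<rho>]] .
    then have "Hausdorff_number X \<le>o \<rho>"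
      using H by simp
    then show ?thesis
      using ordIso_symmetric[OF \<rho>] by (rule ordLeq_ordIso_trans)
  qed
qed

end

(* Replace the end point 0 of [0,1] by n copies of it. Any n + 1 points include two with
   distinct images in [0,1], and these can be separated, whereas neighbourhoods of the n
   copies of 0 always share an interval (0,e). The space is a union of n copies of [0,1]. *)
theory Submission
  imports Defs
begin

text \<open>The Hausdorff number is the least cardinal with the separation property, and the
  property passes to larger cardinals. Hence the Hausdorff number never has to be computed.\<close>

lemma k_Hausdorff_iff: "k_Hausdorff k X \<longleftrightarrow> separates_subsets_of_card X |{..<k}|"
proof
  assume "k_Hausdorff k X"
  then show "separates_subsets_of_card X |{..<k}|"
    using is_Hausdorff_number_Hausdorff_number[of X] separates_subsets_of_card_mono
    unfolding k_Hausdorff_def is_Hausdorff_number_def by blast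
next
  assume "separates_subsets_of_card X |{..<k}|"
  then show "k_Hausdorff k X"
    unfolding k_Hausdorff_def by (intro Hausdorff_number_least card_of_Card_order)
qed

(* The elements of Z, meant to be non-positive reals, are the copies of 0; the map
   (\<lambda>x. max x 0) is the projection to [0,1]. *)
definition multi_origin :: "real set \<Rightarrow> real topology" where
  "multi_origin Z = topology (\<lambda>U. U \<subseteq> {0<..1} \<union> Z \<and>
     (\<forall>x\<in>U. \<exists>e>0. \<forall>y\<in>{0<..1}. \<bar>y - max x 0\<bar> < e \<longrightarrow> y \<in> U))"

text \<open>Only points \<open>y\<close> of (0,1] are tested, so a neighbourhood of one copy of 0
  need not contain another copy. For an intersection of two open sets the smaller radius
  serves.\<close>

lemma openin_multi_origin:
  "openin (multi_origin Z) U \<longleftrightarrow> U \<subseteq> {0<..1} \<union> Z \<and>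
     (\<forall>x\<in>U. \<exists>e>0. \<forall>y\<in>{0<..1}. \<bar>y - max x 0\<bar> < e \<longrightarrow> y \<in> U)"
proof -
  have "istopology (\<lambda>U. U \<subseteq> {0<..1} \<union> Z \<and>
     (\<forall>x\<in>U. \<exists>e>0. \<forall>y\<in>{0<..1}. \<bar>y - max x 0\<bar> < e \<longrightarrow> y \<in> U))" (is "istopology ?P")
    unfolding istopology_def
  proof (intro conjI allI impI)
    fix S T assume S: "?P S" and T: "?P T"
    show "S \<inter> T \<subseteq> {0<..1} \<union> Z" using S by blast
    show "\<forall>x\<in>S \<inter> T. \<exists>e>0. \<forall>y\<in>{0<..1}. \<bar>y - max x 0\<bar> < e \<longrightarrow> y \<in> S \<inter> T"
    proof
      fix x assume "x \<in> S \<inter> T"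
      then obtain d e where "d > 0" "\<forall>y\<in>{0<..1}. \<bar>y - max x 0\<bar> < d \<longrightarrow> y \<in> S"
        and "e > 0" "\<forall>y\<in>{0<..1}. \<bar>y - max x 0\<bar> < e \<longrightarrow> y \<in> T"
        using S T by blast
      then show "\<exists>e>0. \<forall>y\<in>{0<..1}. \<bar>y - max x 0\<bar> < e \<longrightarrow> y \<in> S \<inter> T"
        by (intro exI[of _ "min d e"]) auto
    qed
  next
    fix K assume K: "\<forall>S\<in>K. ?P S"
    show "\<Union>K \<subseteq> {0<..1} \<union> Z" using K by blast
    show "\<forall>x\<in>\<Union>K. \<exists>e>0. \<forall>y\<in>{0<..1}. \<bar>y - max x 0\<bar> < e \<longrightarrow> y \<in> \<Union>K"
      using K by (meson UnionE UnionI)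
  qed
  then show ?thesis
    by (simp add: multi_origin_def topology_inverse')
qed

lemma openin_multi_originE:
  assumes "openin (multi_origin Z) U" "x \<in> U"
  obtains e where "e > 0" "\<And>y. y \<in> {0<..1} \<Longrightarrow> \<bar>y - max x 0\<bar> < e \<Longrightarrow> y \<in> U"
  using assms unfolding openin_multi_origin by blast

lemma topspace_multi_origin [simp]: "topspace (multi_origin Z) = {0<..1} \<union> Z"
proof
  show "topspace (multi_origin Z) \<subseteq> {0<..1} \<union> Z"
    using openin_topspace[of "multi_origin Z"] unfolding openin_multi_origin by blast
  have "openin (multi_origin Z) ({0<..1} \<union> Z)"
    unfolding openin_multi_origin by (auto intro: exI[of _ 1])
  then show "{0<..1} \<union> Z \<subseteq> topspace (multi_origin Z)"
    by (rule openin_subset)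
qed

text \<open>This is continuity of the projection to [0,1]. It pulls disjoint open sets of reals back
  to disjoint neighbourhoods.\<close>

lemma openin_multi_origin_vimage:
  assumes "open V"
  shows "openin (multi_origin Z) {x \<in> {0<..1} \<union> Z. max x 0 \<in> V}"
  unfolding openin_multi_origin
proof (intro conjI ballI)
  fix x assume "x \<in> {x \<in> {0<..1} \<union> Z. max x 0 \<in> V}"
  then obtain e where "e > 0" "\<forall>y. dist y (max x 0) < e \<longrightarrow> y \<in> V"
    using assms unfolding open_dist by blast
  then show "\<exists>e>0. \<forall>y\<in>{0<..1}. \<bar>y - max x 0\<bar> < e \<longrightarrow> y \<in> {x \<in> {0<..1} \<union> Z. max x 0 \<in> V}"
    by (intro exI[of _ e]) (auto simp: dist_real_def)
qed auto

lemma t1_space_multi_origin: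
  assumes "Z \<subseteq> {..0}"
  shows "t1_space (multi_origin Z)"
  unfolding t1_space_def
proof (intro ballI impI)
  fix x y assume x: "x \<in> topspace (multi_origin Z)" and "x \<noteq> y"
  have "openin (multi_origin Z) ({0<..1} \<union> Z - {y})"
    unfolding openin_multi_origin
  proof (intro conjI ballI)
    fix u assume u: "u \<in> {0<..1} \<union> Z - {y}"
    \<comment> \<open>The radius must exclude \<open>y\<close>. If \<open>y \<le> 0\<close>, no
      point of (0,1] equals \<open>y\<close> and any radius works; otherwise
      \<open>u \<noteq> y\<close> forces the projection of \<open>u\<close> to differ from
      \<open>y\<close>.\<close>
    define e where "e = (if y \<le> 0 then 1 else \<bar>y - max u 0\<bar>)"
    have "e > 0" using u by (auto simp: e_def max_def)
    moreover have "\<forall>w\<in>{0<..1}. \<bar>w - max u 0\<bar> < e \<longrightarrow> w \<in> {0<..1} \<union> Z - {y}"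
      by (auto simp: e_def)
    ultimately show "\<exists>e>0. \<forall>w\<in>{0<..1}. \<bar>w - max u 0\<bar> < e \<longrightarrow> w \<in> {0<..1} \<union> Z - {y}"
      by blast
  qed auto
  then show "\<exists>U. openin (multi_origin Z) U \<and> x \<in> U \<and> y \<notin> U"
    using x \<open>x \<noteq> y\<close> by (intro exI[of _ "{0<..1} \<union> Z - {y}"]) auto
qed

text \<open>For each \<open>z\<close> in \<open>Z\<close>, the set (0,1] with \<open>z\<close> added
  is the continuous image of [0,1] under \<open>?f z\<close>, which sends 0 to \<open>z\<close>.
  Finitely many of these compact sets cover the space.\<close>

lemma compact_space_multi_origin:
  assumes "finite Z" "Z \<noteq> {}" "Z \<subseteq> {..0}"
  shows "compact_space (multi_origin Z)"
proof -
  let ?f = "\<lambda>z t :: real. if t = 0 then z else t"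
  have "compactin (multi_origin Z) (?f z ` {0..1})" if "z \<in> Z" for z
  proof (rule image_compactin)
    show "compactin (top_of_set {0..1}) {0..1::real}"
      by (simp add: compactin_subtopology)
    show "continuous_map (top_of_set {0..1}) (multi_origin Z) (?f z)"
      unfolding continuous_map_def
    proof (intro conjI allI impI)
      show "?f z \<in> topspace (top_of_set {0..1}) \<rightarrow> topspace (multi_origin Z)"
        using that by auto
      fix U assume U: "openin (multi_origin Z) U"
      have "\<exists>e>0. \<forall>s\<in>{0..1}. dist s t < e \<longrightarrow> ?f z s \<in> U"
        if t: "t \<in> {0..1}" "?f z t \<in> U" for t
      proof -
        have proj: "max (?f z t) 0 = t"
          using t \<open>z \<in> Z\<close> assms(3) by auto
        obtain e where e: "e > 0" "\<And>y. y \<in> {0<..1} \<Longrightarrow> \<bar>y - t\<bar> < e \<Longrightarrow> y \<in> U"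
          by (rule openin_multi_originE[OF U t(2)]) (simp only: proj)
        show ?thesis
        \<comment> \<open>For \<open>t = 0\<close> the image of 0 is \<open>z\<close>, already known
          to lie in \<open>U\<close>. For \<open>t > 0\<close> the radius \<open>min e t\<close>
          keeps \<open>s\<close> away from 0, whose image \<open>z\<close> may lie outside
          \<open>U\<close>.\<close>
        proof (cases "t = 0")
          case True
          then show ?thesis
            using e t by (intro exI[of _ e]) (auto simp: dist_real_def)
        next
          case False
          then show ?thesis
            using e t by (intro exI[of _ "min e t"]) (auto simp: dist_real_def)
        qed
      qed
      then show "openin (top_of_set {0..1}) {t \<in> topspace (top_of_set {0..1}). ?f z t \<in> U}"
        unfolding openin_euclidean_subtopology_iff by auto
    qed
  qed
  then have "compactin (multi_origin Z) (\<Union>z\<in>Z. ?f z ` {0..1})"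
    using assms(1) by (intro compactin_Union) auto
  moreover have "(\<Union>z\<in>Z. ?f z ` {0..1}) = {0<..1} \<union> Z"
  proof
    show "(\<Union>z\<in>Z. ?f z ` {0..1}) \<subseteq> {0<..1} \<union> Z" by auto
    obtain z where "z \<in> Z" using assms(2) by blast
    have "x \<in> ?f z ` {0..1}" if "x \<in> {0<..1}" for x
      using that by (intro image_eqI[of _ _ x]) auto
    moreover have "x \<in> ?f x ` {0..1}" for x
      by (intro image_eqI[of _ _ 0]) auto
    ultimately show "{0<..1} \<union> Z \<subseteq> (\<Union>z\<in>Z. ?f z ` {0..1})"
      using \<open>z \<in> Z\<close> by blast
  qed
  ultimately show ?thesis
    by (simp add: compact_space_def)
qed

lemma first_countable_multi_origin:
  assumes "Z \<subseteq> {..0}"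
  shows "first_countable (multi_origin Z)"
  unfolding first_countable_def
proof
  fix x assume x: "x \<in> topspace (multi_origin Z)"
  \<comment> \<open>\<open>x\<close> is inserted separately because a copy of 0 is not in (0,1]. No
    other copy of 0 enters, which is why \<open>B k\<close> fits into every open set around
    \<open>x\<close> once its radius is small.\<close>
  define B where "B k = insert x {y \<in> {0<..1}. \<bar>y - max x 0\<bar> < inverse (real (Suc k))}" for k
  have "openin (multi_origin Z) (B k)" for k
    unfolding openin_multi_origin
  proof (intro conjI ballI)
    show "B k \<subseteq> {0<..1} \<union> Z" using x by (auto simp: B_def)
    fix u assume u: "u \<in> B k"
    \<comment> \<open>The distance left between the projection of \<open>u\<close> and the boundary
      of the ball around the projection of \<open>x\<close>.\<close>
    define e where "e = inverse (real (Suc k)) - \<bar>max u 0 - max x 0\<bar>"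
    have "e > 0" using u by (auto simp: B_def e_def)
    moreover have "\<bar>y - max x 0\<bar> < inverse (real (Suc k))" if "\<bar>y - max u 0\<bar> < e" for y
      using that abs_triangle_ineq[of "y - max u 0" "max u 0 - max x 0"] unfolding e_def by simp
    then have "\<forall>y\<in>{0<..1}. \<bar>y - max u 0\<bar> < e \<longrightarrow> y \<in> B k"
      unfolding B_def by blast
    ultimately show "\<exists>e>0. \<forall>y\<in>{0<..1}. \<bar>y - max u 0\<bar> < e \<longrightarrow> y \<in> B k" by blast
  qed
  moreover have "\<exists>k. B k \<subseteq> U" if U: "openin (multi_origin Z) U" "x \<in> U" for U
  proof -
    obtain e where e: "e > 0" "\<And>y. y \<in> {0<..1} \<Longrightarrow> \<bar>y - max x 0\<bar> < e \<Longrightarrow> y \<in> U"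
      using openin_multi_originE[OF U] by blast
    obtain k where k: "inverse (real (Suc k)) < e"
      using reals_Archimedean[OF e(1)] by blast
    have "B k \<subseteq> U"
      unfolding B_def using U(2) e(2) order.strict_trans[OF _ k] by blast
    then show ?thesis ..
  qed
  ultimately show "\<exists>\<B>. countable \<B> \<and> (\<forall>V\<in>\<B>. openin (multi_origin Z) V) \<and>
      (\<forall>U. openin (multi_origin Z) U \<and> x \<in> U \<longrightarrow> (\<exists>V\<in>\<B>. x \<in> V \<and> V \<subseteq> U))"
    by (intro exI[of _ "range B"]) (auto simp: B_def)
qed

text \<open>Each \<open>U a\<close> contains all sufficiently small positive reals. Stated with the
  filter \<open>at_right 0\<close>, this survives finite conjunctions, so no minimum of radii has to
  be formed.\<close>

lemma multi_origin_nhds_meet: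
  assumes "finite A" "A \<subseteq> {..0}" and U: "\<And>a. a \<in> A \<Longrightarrow> openin (multi_origin Z) (U a) \<and> a \<in> U a"
  shows "topspace (multi_origin Z) \<inter> (\<Inter>a\<in>A. U a) \<noteq> {}"
proof -
  have "eventually (\<lambda>y. y \<in> U a) (at_right 0)" if a: "a \<in> A" for a
  proof -
    have proj: "max a 0 = 0" using a assms(2) by auto
    obtain e where "e > 0" "\<And>y. y \<in> {0<..1} \<Longrightarrow> \<bar>y - 0\<bar> < e \<Longrightarrow> y \<in> U a"
      by (rule openin_multi_originE[of Z "U a" a]) (use U[OF a] in \<open>simp_all only: proj\<close>)
    then show ?thesis
      unfolding eventually_at_right_field by (intro exI[of _ "min e 1"]) auto
  qed
  then have "eventually (\<lambda>y. \<forall>a\<in>A. y \<in> U a) (at_right 0)"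
    using assms(1) by (simp add: eventually_ball_finite)
  moreover have "eventually (\<lambda>y::real. y \<in> {0<..1}) (at_right 0)"
    unfolding eventually_at_right_field by (intro exI[of _ 1]) auto
  ultimately have "eventually (\<lambda>y. y \<in> {0<..1} \<and> (\<forall>a\<in>A. y \<in> U a)) (at_right 0)"
    by (simp add: eventually_conj_iff)
  then obtain y where "y \<in> {0<..1}" "\<forall>a\<in>A. y \<in> U a"
    using eventually_happens'[OF trivial_limit_at_right_real] by blast
  then show ?thesis by auto
qed

text \<open>Serves to refute regularity and normality, since either of them together with T1 would
  imply Hausdorff.\<close>

lemma not_Hausdorff_space_multi_origin:
  assumes "Z \<subseteq> {..0}" "a \<in> Z" "b \<in> Z" "a \<noteq> b"
  shows "\<not> Hausdorff_space (multi_origin Z)"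
proof
  assume "Hausdorff_space (multi_origin Z)"
  then obtain V W where VW: "openin (multi_origin Z) V" "openin (multi_origin Z) W"
      "a \<in> V" "b \<in> W" "disjnt V W"
    using assms unfolding Hausdorff_space_def by (metis UnI2 topspace_multi_origin)
  \<comment> \<open>The pair \<open>V\<close>, \<open>W\<close> is recast as a family indexed by the
    two points.\<close>
  have "topspace (multi_origin Z) \<inter> (\<Inter>c\<in>{a, b}. if c = a then V else W) \<noteq> {}"
    using VW assms by (intro multi_origin_nhds_meet) auto
  then show False
    using VW(5) \<open>a \<noteq> b\<close> by (auto simp: disjnt_def)
qed

text \<open>The set \<open>Z\<close> of all copies of 0 is itself the counterexample.\<close>

lemma not_k_Hausdorff_multi_origin:
  assumes "finite Z" "Z \<subseteq> {..0}"
  shows "\<not> k_Hausdorff (card Z) (multi_origin Z)"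
proof
  assume "k_Hausdorff (card Z) (multi_origin Z)"
  moreover have "|{..<card Z}| \<le>o |Z|"
    using card_le_inj[of "{..<card Z}" Z] assms(1) card_of_ordLeq[of "{..<card Z}" Z] by auto
  ultimately obtain U where "\<forall>a\<in>Z. openin (multi_origin Z) (U a) \<and> a \<in> U a"
      "topspace (multi_origin Z) \<inter> (\<Inter>a\<in>Z. U a) = {}"
    unfolding k_Hausdorff_iff separates_subsets_of_card_def by (metis Un_upper2 topspace_multi_origin)
  then show False
    using multi_origin_nhds_meet[OF assms] by blast
qed

lemma k_Hausdorff_multi_origin:
  assumes "finite Z" "Z \<noteq> {}" "Z \<subseteq> {..0}"
  shows "k_Hausdorff (card Z + 1) (multi_origin Z)"
  unfolding k_Hausdorff_iff separates_subsets_of_card_def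
proof (intro allI impI, elim conjE)
  fix A assume A: "A \<subseteq> topspace (multi_origin Z)" and card: "|{..<card Z + 1}| \<le>o |A|"
  \<comment> \<open>\<open>A\<close> may be infinite, so a subset \<open>F\<close> of exactly
    \<open>card Z + 1\<close> points is taken for the pigeonhole argument.\<close>
  obtain f where f: "inj_on f {..<card Z + 1}" "f ` {..<card Z + 1} \<subseteq> A"
    using card card_of_ordLeq by metis
  define F where "F = f ` {..<card Z + 1}"
  have F: "F \<subseteq> A" "finite F" "card F = card Z + 1"
    using f by (auto simp: F_def card_image)
  have "card Z > 0" using assms by (simp add: card_gt_0_iff)
  have "\<not> F \<subseteq> Z" using card_mono[OF assms(1), of F] F by auto
  then obtain a where a: "a \<in> F" "a \<notin> Z" by blast
  \<comment> \<open>As \<open>Z\<close> is nonempty, \<open>F\<close> has at least two points. Any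
    second point \<open>b\<close> will do: since \<open>a > 0\<close>, its projection differs from
    that of \<open>a\<close> whether or not \<open>b\<close> is a copy of 0.\<close>
  have "\<not> F \<subseteq> {a}" using card_mono[of "{a}" F] F \<open>card Z > 0\<close> by auto
  then obtain b where b: "b \<in> F" "b \<noteq> a" by blast
  have "a > 0" using a F A by auto
  then have "max a 0 \<noteq> max b 0" using b by auto
  then obtain V W where VW: "open V" "open W" "max a 0 \<in> V" "max b 0 \<in> W" "V \<inter> W = {}"
    using hausdorff by metis
  define P where "P V = {x \<in> {0<..1} \<union> Z. max x 0 \<in> V}" for V
  \<comment> \<open>Separating \<open>a\<close> from \<open>b\<close> already empties the
    intersection, so every other point receives the whole space.\<close>
  define U where "U c = P (if c = a then V else if c = b then W else UNIV)" for c
  have "\<forall>c\<in>A. openin (multi_origin Z) (U c) \<and> c \<in> U c"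
  proof
    fix c assume "c \<in> A"
    have "openin (multi_origin Z) (U c)"
      using VW unfolding U_def P_def by (intro openin_multi_origin_vimage) simp
    moreover have "c \<in> U c"
      using A \<open>c \<in> A\<close> VW by (auto simp: U_def P_def)
    ultimately show "openin (multi_origin Z) (U c) \<and> c \<in> U c" ..
  qed
  moreover have "U a \<inter> U b = {}"
    using VW b by (auto simp: U_def P_def)
  moreover have "a \<in> A" "b \<in> A" using a b F by auto
  ultimately show "\<exists>U. (\<forall>c\<in>A. openin (multi_origin Z) (U c) \<and> c \<in> U c) \<and>
      topspace (multi_origin Z) \<inter> (\<Inter>c\<in>A. U c) = {}"
    by (intro exI[of _ U]) blast
qed

theorem mainTheorem1:
  fixes n :: nat
  assumes "n \<ge> 2"
  shows "\<exists>X :: real topology.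
    uncountable (topspace X) \<and> t1_space X \<and> compact_space X \<and> first_countable X \<and>
    k_Hausdorff (n + 1) X \<and> \<not> k_Hausdorff n X \<and>
    \<not> regular_space X \<and> \<not> normal_space X"
proof -
  \<comment> \<open>Any \<open>n\<close> distinct non-positive reals would do as copies of 0;
    \<open>n \<ge> 2\<close> ensures that 0 and -1 are among these.\<close>
  define Z where "Z = (\<lambda>i. - real i) ` {..<n}"
  have Z: "finite Z" "Z \<subseteq> {..0}" and card: "card Z = n"
    by (auto simp: Z_def card_image inj_on_def)
  have mem: "0 \<in> Z" "-1 \<in> Z"
    using assms by (auto simp: Z_def intro: image_eqI[of _ _ 0] image_eqI[of _ _ 1])
  let ?X = "multi_origin Z"
  have "uncountable (topspace ?X)"
    using uncountable_half_open_interval_2[of 0 1] countable_subset[of "{0<..1}" "topspace ?X"]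
    by auto
  moreover have t1: "t1_space ?X"
    using Z by (intro t1_space_multi_origin)
  moreover have "compact_space ?X" "first_countable ?X"
    using Z mem by (auto intro: compact_space_multi_origin first_countable_multi_origin)
  moreover have "k_Hausdorff (n + 1) ?X" "\<not> k_Hausdorff n ?X"
    using k_Hausdorff_multi_origin[of Z] not_k_Hausdorff_multi_origin[of Z] Z mem card by auto
  moreover have "\<not> Hausdorff_space ?X"
    using not_Hausdorff_space_multi_origin[OF Z(2) mem] by simp
  then have "\<not> regular_space ?X" "\<not> normal_space ?X"
    using t1 regular_t1_imp_Hausdorff_space normal_t1_imp_Hausdorff_space by blast+
  ultimately show ?thesis by blast
qed

end
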